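(* Let $\mu$ be a Borel probability measure on the unit circle $\mathbb{S}^1$ and let $p^*\in\mathbb{S}^1$ be a critical point of the Fréchet functional $F_\mu$. Then the following propositions are equivalent. 1. $p^*$ is a well defined Fréchet mean of $\mu$, i.e. $p^*$ is the unique point of $\mathbb{S}^1$ at which $F_\mu$ attains its minimum over $\mathbb{S}^1$. 2. For all $0<\theta<\pi$, $$\int_{0}^{\theta} \Big(\lambda([-\pi,-\pi+t)) -\mu_{p^*}([-\pi,-\pi+t))\Big)\,dt >0,$$ and for all $-\pi\leq\theta<0$, $$\int_{\theta}^{0} \Big(\lambda((\pi+t,\pi)) -\mu_{p^*}((\pi+t,\pi))\Big)\, dt >0,$$ where $\lambda$ is the uniform probability measure on $[-\pi,\pi)$.
   Context: $\mathbb{S}^1=\{(x_1,x_2)\in\mathbb{R}^2 : x_1^2+x_2^2=1\}$ is endowed with the arclength distance $d_{\mathbb{S}^1}(x,p)=2\arcsin(\|x-p\|/2)$, with $\|\cdot\|$ the Euclidean norm. For a Borel probability measure $\mu$ on $\mathbb{S}^1$, the Fréchet functional is $F_\mu(p)=\frac12\int_{\mathbb{S}^1} d_{\mathbb{S}^1}^2(x,p)\,d\mu(x)$, $p\in\mathbb{S}^1$. For $p\in\mathbb{S}^1$, $e_p:[-\pi,\pi)\to\mathbb{S}^1$ is the bijection $e_p(\theta)=R_\theta p$, with $R_\theta$ the rotation of angle $\theta$. $\mu_p$ is the image measure of $\mu$ under $e_p^{-1}$, a probability measure on $\mathbb{R}$ carried by $[-\pi,\pi)$, and $m(\mu_p)=\int_{\mathbb{R}}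 t\,d\mu_p(t)$. Critical points: for $p_0\in\mathbb{S}^1$ put $F_{\mu_{p_0}}(\theta)=F_\mu(e_{p_0}(\theta))$, $\theta\in[-\pi,\pi)$ (extended $2\pi$-periodically). Its derivative exists at every $\theta$ such that $\mu(\{-e_{p_0}(\theta)\})=0$, and it is extended to all $\theta$ by taking left limits. A point $p=e_{p_0}(\theta)$ is a critical point of $F_\mu$ if this (extended) derivative vanishes at $\theta$; this does not depend on $p_0$, and the critical points are precisely the points $p\in\mathbb{S}^1$ with $m(\mu_p)=0$. *)

theory Defs
  imports "HOL-Probability.Probability"
begin

abbreviation circle :: "(real^2) set" where
  "circle \<equiv> sphere 0 1"

definition circle_dist :: "real^2 \<Rightarrow> real^2 \<Rightarrow> real" where
  "circle_dist x p = 2 * arcsin (norm (x - p) / 2)"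

text \<open>The library integral is meaningful here: on the circle the integrand is bounded and continuous.\<close>
definition frechet_functional :: "(real^2) measure \<Rightarrow> real^2 \<Rightarrow> real" where
  "frechet_functional \<mu> p = 1/2 * (\<integral>x. (circle_dist x p)\<^sup>2 \<partial>\<mu>)"

definition is_frechet_mean :: "(real^2) measure \<Rightarrow> real^2 \<Rightarrow> bool" where
  "is_frechet_mean \<mu> p \<longleftrightarrow> is_arg_min (frechet_functional \<mu>) (\<lambda>q. q \<in> circle) p"

definition well_defined_frechet_mean :: "(real^2) measure \<Rightarrow> real^2 \<Rightarrow> bool" where
  "well_defined_frechet_mean \<mu> p \<longleftrightarrow> (\<forall>q. is_frechet_mean \<mu> q \<longleftrightarrow> q = p)"

text \<open>The rotation of \<open>p\<close> by \<open>\<theta>\<close>. It is defined for every real angle and is the bijection \<open>e\<^sub>p\<close>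
  when \<open>\<theta>\<close> is restricted to \<open>[-\<pi>, \<pi>)\<close>.\<close>
definition rot :: "real^2 \<Rightarrow> real \<Rightarrow> real^2" where
  "rot p \<theta> = vector [cos \<theta> * p $ 1 - sin \<theta> * p $ 2, sin \<theta> * p $ 1 + cos \<theta> * p $ 2]"

text \<open>The image measure \<open>\<mu>\<^sub>p\<close> of \<open>\<mu>\<close> under the inverse of \<open>e\<^sub>p\<close>.\<close>
definition angle_measure :: "(real^2) measure \<Rightarrow> real^2 \<Rightarrow> real measure" where
  "angle_measure \<mu> p = distr \<mu> borel (inv_into {-pi..<pi} (rot p))"

text \<open>Defined on the whole line, this is the \<open>2\<pi>\<close>-periodic extension of \<open>F\<^sub>\<mu> \<circ> e\<^sub>p\<close>.\<close>
definition frechet_lift :: "(real^2) measure \<Rightarrow> real^2 \<Rightarrow> real \<Rightarrow> real" where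
  "frechet_lift \<mu> p \<theta> = frechet_functional \<mu> (rot p \<theta>)"

text \<open>The derivative of the lift, extended by left limits to the angles whose antipode carries
  an atom. It is stated as a relation, so that no default value of \<open>deriv\<close> or \<open>Lim\<close> can
  intervene. There are only countably many atoms, so the limit is taken along a nontrivial filter.\<close>
definition has_extended_deriv :: "(real^2) measure \<Rightarrow> real^2 \<Rightarrow> real \<Rightarrow> real \<Rightarrow> bool" where
  "has_extended_deriv \<mu> p D \<theta> \<longleftrightarrow>
     (if measure \<mu> {- rot p \<theta>} = 0
      then (frechet_lift \<mu> p has_real_derivative D) (at \<theta>)
      else (deriv (frechet_lift \<mu> p) \<longlongrightarrow> D)
             (at \<theta> within {s. s < \<theta> \<and> measure \<mu> {- rot p s} = 0}))"

text \<open>The choice of the base point \<open>p\<^sub>0\<close> is immaterial; the existential form makes this the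
  weakest hypothesis.\<close>
definition frechet_critical_point :: "(real^2) measure \<Rightarrow> real^2 \<Rightarrow> bool" where
  "frechet_critical_point \<mu> p \<longleftrightarrow>
     (\<exists>p\<^sub>0\<in>circle. \<exists>\<theta>\<in>{-pi..<pi}. p = rot p\<^sub>0 \<theta> \<and> has_extended_deriv \<mu> p\<^sub>0 0 \<theta>)"

definition uniform_angle :: "real measure" where
  "uniform_angle = uniform_measure lborel {-pi..<pi}"

end

theory Submission
  imports Defs
begin

text \<open>
  In the angular coordinate around \<open>p\<close>, the Frechet functional is an explicit parabola minus
  a correction. For \<open>s \<in> [-\<pi>, \<pi>)\<close> and \<open>\<bar>\<theta>\<bar> \<le> \<pi>\<close>, the squared arclength between the
  rotations by \<open>s\<close> and by \<open>\<theta>\<close> is \<open>(s - \<theta>)\<^sup>2 - 4 \<pi> max 0 (\<bar>s - \<theta>\<bar> - \<pi>)\<close>: the naive square of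
  the difference of the angles, corrected when the shorter arc runs through the cut at the antipode
  of \<open>p\<close>. Integrating against the angular law \<open>\<nu>\<close>, with mean \<open>m\<close>, gives
  \<open>F(\<theta>) = F(0) + \<theta>\<^sup>2/2 - \<theta> m - 2 \<pi> E(\<theta>)\<close>, where \<open>E(\<theta>)\<close> is the \<open>\<nu>\<close>-mean of
  \<open>max 0 (\<bar>s - \<theta>\<bar> - \<pi>)\<close> (\<open>frechet_lift_expansion\<close>).

  By Fubini, \<open>E(\<theta>)\<close> is the integral of \<open>\<nu>([-\<pi>, -\<pi> + t))\<close> over \<open>[0, \<theta>]\<close> if \<open>\<theta> \<ge> 0\<close>, and of
  \<open>\<nu>((\<pi> + t, \<pi>))\<close> over \<open>[\<theta>, 0]\<close> if \<open>\<theta> \<le> 0\<close> (\<open>excess_forward\<close>, \<open>excess_backward\<close>). For the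
  uniform law the same integrals equal \<open>\<theta>\<^sup>2/(4 \<pi>)\<close>. So, when \<open>m = 0\<close>, the difference
  \<open>F(\<theta>) - F(0)\<close> is \<open>2 \<pi>\<close> times the integral in the second proposition, and both propositions say
  that \<open>F(\<theta>) > F(0)\<close> for every \<open>\<theta> \<in> [-\<pi>, \<pi>)\<close> other than 0.

  It remains to see that a critical point has \<open>m = 0\<close> (\<open>mean_angle_eq_zero_if_critical\<close>).
  To the left of 0, at the angles whose antipode is not an atom, the expansion differentiates to
  \<open>\<theta> - m + 2 \<pi> \<nu>((\<pi> + \<theta>, \<pi>))\<close>, and
  \<open>\<nu>((\<pi> + \<theta>, \<pi>))\<close> tends to 0 as \<open>\<theta>\<close> increases to 0, whether or not the antipode of \<open>p\<close> carries
  an atom, since an atom there sits at the angle \<open>-\<pi>\<close>. The derivative at 0 from the left and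
  the left limit of the derivatives are therefore both \<open>-m\<close>.
\<close>

section \<open>Rotations of the circle\<close>

lemma rot_component [simp]:
  "rot p \<theta> $ 1 = cos \<theta> * p $ 1 - sin \<theta> * p $ 2"
  "rot p \<theta> $ 2 = sin \<theta> * p $ 1 + cos \<theta> * p $ 2"
  by (simp_all add: rot_def)

lemma rot_zero [simp]: "rot p 0 = p"
  by (simp add: vec_eq_iff forall_2)

lemma rot_rot: "rot (rot p a) b = rot p (a + b)"
  by (simp add: vec_eq_iff forall_2 cos_add sin_add algebra_simps)

lemma minus_rot: "- rot p \<theta> = rot p (\<theta> + pi)"
  by (simp add: vec_eq_iff forall_2)

text \<open>Multiplicativity of the norm of the complex numbers. Rotations, their differences, and the
  coordinates of one unit vector relative to another are all complex products, so this identity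
  computes each of their norms.\<close>

lemma two_squares_identity:
  fixes a b c d :: real
  shows "(a * c - b * d)\<^sup>2 + (b * c + a * d)\<^sup>2 = (a\<^sup>2 + b\<^sup>2) * (c\<^sup>2 + d\<^sup>2)"
  by (simp add: power2_eq_square algebra_simps)

lemma circle_iff: "p \<in> circle \<longleftrightarrow> (p $ 1)\<^sup>2 + (p $ 2)\<^sup>2 = (1::real)"
  by (simp add: norm_vec_def L2_set_def sum_2)

lemma norm_rot [simp]: "norm (rot p \<theta>) = norm p"
  by (simp add: norm_vec_def L2_set_def sum_2 two_squares_identity)

lemma norm_rot_diff:
  assumes "p \<in> circle"
  shows "norm (rot p s - rot p \<theta>) = 2 * \<bar>sin ((s - \<theta>) / 2)\<bar>"
proof -
  have "(norm (rot p s - rot p \<theta>))\<^sup>2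
      = ((cos s - cos \<theta>) * p $ 1 - (sin s - sin \<theta>) * p $ 2)\<^sup>2
        + ((sin s - sin \<theta>) * p $ 1 + (cos s - cos \<theta>) * p $ 2)\<^sup>2"
    by (simp add: norm_vec_def L2_set_def sum_2 algebra_simps)
  also have "\<dots> = (cos s - cos \<theta>)\<^sup>2 + (sin s - sin \<theta>)\<^sup>2"
    using assms unfolding two_squares_identity circle_iff by simp
  also have "\<dots> = ((sin s)\<^sup>2 + (cos s)\<^sup>2) + ((sin \<theta>)\<^sup>2 + (cos \<theta>)\<^sup>2)
      - 2 * (cos s * cos \<theta> + sin s * sin \<theta>)"
    by (simp add: power2_eq_square algebra_simps)
  also have "\<dots> = 2 - 2 * cos (2 * ((s - \<theta>) / 2))"
  proof -
    have "2 * ((s - \<theta>) / 2) = s - \<theta>" by simp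
    then show ?thesis by (simp only: cos_diff sin_cos_squared_add)
  qed
  also have "\<dots> = (2 * \<bar>sin ((s - \<theta>) / 2)\<bar>)\<^sup>2"
    unfolding cos_double_sin by (simp add: power2_eq_square)
  finally show ?thesis
    by (rule power2_eq_imp_eq) auto
qed

lemma bij_betw_rot:
  assumes "p \<in> circle"
  shows "bij_betw (rot p) {-pi..<pi} circle"
proof (rule bij_betw_imageI)
  show "inj_on (rot p) {-pi..<pi}"
  proof (rule inj_onI)
    fix s \<theta> assume st: "s \<in> {-pi..<pi}" "\<theta> \<in> {-pi..<pi}" and "rot p s = rot p \<theta>"
    then have "sin ((s - \<theta>) / 2) = 0"
      using norm_rot_diff[OF assms, of s \<theta>] by simp
    then have "(s - \<theta>) / 2 = 0"
      using st sin_eq_0_pi[of "(s - \<theta>) / 2"] by (simp add: field_simps)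
    then show "s = \<theta>" by simp
  qed
  show "rot p ` {-pi..<pi} = circle"
  proof (intro equalityI subsetI)
    fix q assume "q \<in> rot p ` {-pi..<pi}"
    then show "q \<in> circle" using assms by auto
  next
    fix q :: "real^2" assume q: "q \<in> circle"
    have p1: "(p $ 1)\<^sup>2 + (p $ 2)\<^sup>2 = 1" and q1: "(q $ 1)\<^sup>2 + (q $ 2)\<^sup>2 = 1"
      using assms q by (simp_all only: circle_iff)
    \<comment> \<open>The cosine and the sine of the angle from \<open>p\<close> to \<open>q\<close>.\<close>
    let ?c = "p $ 1 * q $ 1 + p $ 2 * q $ 2" and ?s = "p $ 1 * q $ 2 - p $ 2 * q $ 1"
    have "?c\<^sup>2 + ?s\<^sup>2 = 1"
      using two_squares_identity[of "p $ 1" "q $ 1" "- p $ 2" "q $ 2"] p1 q1 by simp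
    then obtain t where t: "0 \<le> t" "t < 2 * pi" "?c = cos t" "?s = sin t"
      using sincos_total_2pi by metis
    have "q = rot p t"
    proof -
      have "cos t * p $ 1 - sin t * p $ 2 = ((p $ 1)\<^sup>2 + (p $ 2)\<^sup>2) * q $ 1"
           "sin t * p $ 1 + cos t * p $ 2 = ((p $ 1)\<^sup>2 + (p $ 2)\<^sup>2) * q $ 2"
        unfolding t(3,4)[symmetric] by (simp_all add: power2_eq_square algebra_simps)
      then show ?thesis
        using p1 by (simp add: vec_eq_iff forall_2)
    qed
    moreover have "rot p t = rot p (t - 2 * pi)"
      by (simp add: vec_eq_iff forall_2 cos_diff sin_diff)
    ultimately show "q \<in> rot p ` {-pi..<pi}"
      using t(1,2) by (cases "t < pi") (auto intro: image_eqI[of _ _ t] image_eqI[of _ _ "t - 2 * pi"])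
  qed
qed

text \<open>The half-angle \<open>u\<close> is at most \<open>\<pi>\<close>, but \<open>arcsin\<close> inverts the sine only up to \<open>\<pi>/2\<close>; beyond
  that it returns \<open>\<pi> - u\<close>, which is why the shorter of the two arcs appears.\<close>

lemma circle_dist_rot:
  assumes "p \<in> circle" "\<bar>s - \<theta>\<bar> \<le> 2 * pi"
  shows "circle_dist (rot p s) (rot p \<theta>) = min \<bar>s - \<theta>\<bar> (2 * pi - \<bar>s - \<theta>\<bar>)"
proof -
  define u where "u = \<bar>s - \<theta>\<bar> / 2"
  have u: "0 \<le> u" "u \<le> pi" "\<bar>s - \<theta>\<bar> = 2 * u"
    using assms(2) by (simp_all add: u_def)
  have "\<bar>sin ((s - \<theta>) / 2)\<bar> = \<bar>sin u\<bar>"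
  proof (cases "s \<le> \<theta>")
    case True
    then have "(s - \<theta>) / 2 = - u"
      unfolding u_def by (subst abs_of_nonpos) (simp_all add: minus_divide_left)
    then show ?thesis by (simp only: sin_minus abs_minus_cancel)
  next
    case False
    then have "(s - \<theta>) / 2 = u"
      unfolding u_def by (subst abs_of_nonneg) simp_all
    then show ?thesis by (simp only:)
  qed
  also have "\<dots> = sin u"
    using u by (simp add: sin_ge_zero)
  finally have d: "circle_dist (rot p s) (rot p \<theta>) = 2 * arcsin (sin u)"
    by (simp add: circle_dist_def norm_rot_diff[OF assms(1)])
  show ?thesis
  proof (cases "u \<le> pi / 2")
    case True
    have "- (pi / 2) \<le> u"
      using u(1) pi_gt_zero by linarith
    then have "arcsin (sin u) = u"
      using True by (rule arcsin_sin)
    then show ?thesis unfolding d u(3) using True by simp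
  next
    case False
    have "- (pi / 2) \<le> pi - u" "pi - u \<le> pi / 2"
      using False u(2) pi_gt_zero by linarith+
    then have "arcsin (sin (pi - u)) = pi - u"
      by (rule arcsin_sin)
    then show ?thesis unfolding d u(3) using False by simp
  qed
qed

text \<open>The form in which the quadratic and the cut-off part can be integrated separately: the cost of
  going the long way round is linear in the overshoot, because
  \<open>u\<^sup>2 - (2 \<pi> - u)\<^sup>2 = 4 \<pi> (u - \<pi>)\<close>.\<close>

lemma circle_dist_rot_squared:
  assumes "p \<in> circle" "\<bar>s - \<theta>\<bar> \<le> 2 * pi"
  shows "(circle_dist (rot p s) (rot p \<theta>))\<^sup>2
    = (s - \<theta>)\<^sup>2 - 4 * pi * max 0 (\<bar>s - \<theta>\<bar> - pi)"
proof (cases "\<bar>s - \<theta>\<bar> \<le> pi")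
  case True
  then have "min \<bar>s - \<theta>\<bar> (2 * pi - \<bar>s - \<theta>\<bar>) = \<bar>s - \<theta>\<bar>" "max 0 (\<bar>s - \<theta>\<bar> - pi) = 0"
    by linarith+
  then show ?thesis
    by (simp only: circle_dist_rot[OF assms] power2_abs mult_zero_right diff_zero)
next
  case False
  then have "min \<bar>s - \<theta>\<bar> (2 * pi - \<bar>s - \<theta>\<bar>) = 2 * pi - \<bar>s - \<theta>\<bar>"
    "max 0 (\<bar>s - \<theta>\<bar> - pi) = \<bar>s - \<theta>\<bar> - pi"
    by linarith+
  moreover have "(2 * pi - \<bar>s - \<theta>\<bar>)\<^sup>2 = \<bar>s - \<theta>\<bar>\<^sup>2 - 4 * pi * (\<bar>s - \<theta>\<bar> - pi)"
    by (simp add: power2_eq_square algebra_simps)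
  ultimately show ?thesis
    by (simp only: circle_dist_rot[OF assms] power2_abs)
qed

section \<open>The mean overshoot as an integral of arc measures\<close>

text \<open>Up to the factor \<open>2 \<pi>\<close>, the amount by which cutting the circle open overestimates the Frechet
  functional. The absolute value covers the two ends of \<open>[-\<pi>, \<pi>)\<close> at once; for each sign of \<open>\<theta>\<close>
  only one of them contributes.\<close>

definition excess :: "real measure \<Rightarrow> real \<Rightarrow> real" where
  "excess \<nu> \<theta> = (\<integral>s. max 0 (\<bar>s - \<theta>\<bar> - pi) \<partial>\<nu>)"

text \<open>Both sides are the product measure of the part of \<open>A\<close> above \<open>[a, b]\<close>, sliced in the two
  directions. Finiteness of \<open>N\<close> and boundedness of \<open>[a, b]\<close> make that measure finite, which is the
  integrability required for exchanging the two integrations.\<close>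

lemma Fubini_section_measure:
  fixes A :: "(real \<times> 'a) set"
  assumes "finite_measure N" and A: "A \<in> sets (lborel \<Otimes>\<^sub>M N)"
  shows "set_integrable lborel {a..b} (\<lambda>t. measure N {x \<in> space N. (t, x) \<in> A})"
    and "(LBINT t:{a..b}. measure N {x \<in> space N. (t, x) \<in> A})
      = (\<integral>x. measure lborel {t \<in> {a..b}. (t, x) \<in> A} \<partial>N)"
proof -
  interpret N: finite_measure N by fact
  interpret pair_sigma_finite lborel N ..
  let ?f = "\<lambda>t x. indicator {a..b} t * indicator A (t, x) :: real"
  have mA: "{x \<in> space N. (t, x) \<in> A} \<in> sets N" for t
    using sets_Pair1[OF A, of t] sets.sets_into_space[OF A]
    by (auto simp: space_pair_measure vimage_def Int_def elim!: back_subst[of "\<lambda>X. X \<in> sets N"])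
  have inner: "(\<integral>x. ?f t x \<partial>N) = indicator {a..b} t * measure N {x \<in> space N. (t, x) \<in> A}" for t
  proof -
    have "(\<integral>x. indicator A (t, x) \<partial>N) = (\<integral>x. indicator {x \<in> space N. (t, x) \<in> A} x \<partial>N :: real)"
      by (intro Bochner_Integration.integral_cong refl) (auto simp: indicator_def)
    then show ?thesis using mA[of t] by simp
  qed
  have outer: "(\<integral>t. ?f t x \<partial>lborel) = measure lborel {t \<in> {a..b}. (t, x) \<in> A}" if "x \<in> space N" for x
  proof -
    have "{t \<in> {a..b}. (t, x) \<in> A} = {a..b} \<inter> (\<lambda>t. (t, x)) -` A" by auto
    then have "{t \<in> {a..b}. (t, x) \<in> A} \<in> sets borel"
      using sets_Pair2[OF A, of x] by simp
    moreover have "(\<integral>t. ?f t x \<partial>lborel) = (\<integral>t. indicator {t \<in> {a..b}. (t, x) \<in> A} t \<partial>lborel)"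
      by (intro Bochner_Integration.integral_cong refl) (auto simp: indicator_def)
    ultimately show ?thesis by simp
  qed
  have "integrable (lborel \<Otimes>\<^sub>M N) (\<lambda>z. indicator (({a..b} \<times> space N) \<inter> A) z :: real)"
  proof (intro integrable_real_indicator)
    show "({a..b} \<times> space N) \<inter> A \<in> sets (lborel \<Otimes>\<^sub>M N)"
      using A by auto
    have "emeasure (lborel \<Otimes>\<^sub>M N) (({a..b} \<times> space N) \<inter> A) \<le> emeasure (lborel \<Otimes>\<^sub>M N) ({a..b} \<times> space N)"
      by (intro emeasure_mono) auto
    also have "\<dots> = emeasure lborel {a..b} * emeasure N (space N)"
      by (rule N.emeasure_pair_measure_Times) auto
    also have "\<dots> < \<infinity>"
      by (simp add: emeasure_lborel_Icc_eq N.emeasure_eq_measure ennreal_mult''[symmetric])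
    finally show "emeasure (lborel \<Otimes>\<^sub>M N) (({a..b} \<times> space N) \<inter> A) < \<infinity>" .
  qed
  then have int: "integrable (lborel \<Otimes>\<^sub>M N) (\<lambda>(t, x). ?f t x)"
    by (rule Bochner_Integration.integrable_cong[THEN iffD1, rotated -1])
       (auto simp: indicator_def space_pair_measure)
  show "set_integrable lborel {a..b} (\<lambda>t. measure N {x \<in> space N. (t, x) \<in> A})"
    using integrable_fst[OF int] unfolding set_integrable_def inner by simp
  show "(LBINT t:{a..b}. measure N {x \<in> space N. (t, x) \<in> A})
      = (\<integral>x. measure lborel {t \<in> {a..b}. (t, x) \<in> A} \<partial>N)"
  proof -
    have "(LBINT t:{a..b}. measure N {x \<in> space N. (t, x) \<in> A}) = (\<integral>t. (\<integral>x. ?f t x \<partial>N) \<partial>lborel)"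
      unfolding set_lebesgue_integral_def inner by simp
    also have "\<dots> = (\<integral>x. (\<integral>t. ?f t x \<partial>lborel) \<partial>N)"
      using Fubini_integral[OF int] by simp
    also have "\<dots> = (\<integral>x. measure lborel {t \<in> {a..b}. (t, x) \<in> A} \<partial>N)"
      by (intro Bochner_Integration.integral_cong refl outer)
    finally show ?thesis .
  qed
qed

lemma measure_uniform_angle:
  assumes "A \<in> sets borel" "A \<subseteq> {-pi..<pi}"
  shows "measure uniform_angle A = measure lborel A / (2 * pi)"
  using assms unfolding uniform_angle_def
  by (subst measure_uniform_measure) (auto simp: Int_absorb1)

lemma set_integral_linear:
  fixes c :: real
  assumes "a \<le> b"
  shows "set_integrable lborel {a..b} (\<lambda>t. c * t)"
    and "(LBINT t:{a..b}. c * t) = c * (b\<^sup>2 - a\<^sup>2) / 2"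
proof -
  have "((\<lambda>t. c * t) has_integral (c * b\<^sup>2 / 2 - c * a\<^sup>2 / 2)) {a..b}"
    by (rule fundamental_theorem_of_calculus[OF assms])
       (auto intro!: derivative_eq_intros simp: has_real_derivative_iff_has_vector_derivative[symmetric])
  moreover show i: "set_integrable lborel {a..b} (\<lambda>t. c * t)"
    by (rule borel_integrable_atLeastAtMost') (intro continuous_intros)
  ultimately have "(LBINT t:{a..b}. c * t) = c * b\<^sup>2 / 2 - c * a\<^sup>2 / 2"
    unfolding set_borel_integral_eq_integral(2)[OF i] by (intro integral_unique)
  then show "(LBINT t:{a..b}. c * t) = c * (b\<^sup>2 - a\<^sup>2) / 2"
    by (simp add: diff_divide_distrib right_diff_distrib)
qed

context
  fixes \<nu> :: "real measure"
  assumes distribution: "real_distribution \<nu>"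
    and carried: "AE s in \<nu>. s \<in> {-pi..<pi}"
begin

interpretation real_distribution \<nu> by (rule distribution)

lemma sets_plane: "sets ((lborel :: real measure) \<Otimes>\<^sub>M \<nu>) = sets borel"
proof -
  have "sets ((lborel :: real measure) \<Otimes>\<^sub>M \<nu>) = sets (borel \<Otimes>\<^sub>M borel)"
    by (intro sets_pair_measure_cong) simp_all
  then show ?thesis unfolding borel_prod .
qed

lemma measure_lower_arc: "measure \<nu> {-pi..<c} = measure \<nu> {..<c}"
  by (rule measure_eq_AE) (use carried in \<open>auto elim: eventually_mono\<close>)

lemma measure_upper_arc: "measure \<nu> {c<..<pi} = measure \<nu> {c<..}"
  by (rule measure_eq_AE) (use carried in \<open>auto elim: eventually_mono\<close>)

lemma measure_upper_arc_cdf: "measure \<nu> {c<..<pi} = 1 - cdf \<nu> c"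
proof -
  have "{c<..} = space \<nu> - {..c}" by auto
  then show ?thesis
    unfolding measure_upper_arc cdf_def using prob_compl[of "{..c}"] by simp
qed

text \<open>For \<open>\<theta> \<ge> 0\<close> only points \<open>x\<close> close to the lower end of \<open>[-\<pi>, \<pi>)\<close> overshoot, by
  \<open>\<theta> - (x + \<pi>)\<close>. That number is the length of the set of \<open>t \<in> [0, \<theta>]\<close> with
  \<open>x < -\<pi> + t\<close>, so exchanging the integrations over \<open>t\<close> and \<open>x\<close> gives the claim.\<close>

lemma excess_forward:
  assumes "0 \<le> \<theta>" "\<theta> \<le> pi"
  shows "set_integrable lborel {0..\<theta>} (\<lambda>t. measure \<nu> {-pi..<-pi + t})"
    and "(LBINT t:{0..\<theta>}. measure \<nu> {-pi..<-pi + t}) = excess \<nu> \<theta>"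
proof -
  have A: "{z. snd z < -pi + fst z} \<in> sets (lborel \<Otimes>\<^sub>M \<nu>)"
    unfolding sets_plane by (intro borel_open open_Collect_less continuous_intros)
  have slice: "{x \<in> space \<nu>. (t, x) \<in> {z. snd z < -pi + fst z}} = {..<-pi + t}" for t
    by auto
  note F = Fubini_section_measure[OF finite_measure_axioms A, of 0 \<theta>, unfolded slice]
  show "set_integrable lborel {0..\<theta>} (\<lambda>t. measure \<nu> {-pi..<-pi + t})"
    unfolding measure_lower_arc by (rule F(1))
  have "measure lborel {t \<in> {0..\<theta>}. (t, x) \<in> {z. snd z < -pi + fst z}} = max 0 (\<bar>x - \<theta>\<bar> - pi)"
    if "x \<in> {-pi..<pi}" for x
  proof -
    have "{t \<in> {0..\<theta>}. (t, x) \<in> {z. snd z < -pi + fst z}} = {x + pi<..\<theta>}"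
      using that by auto
    moreover have "measure lborel {x + pi<..\<theta>} = max 0 (\<theta> - (x + pi))"
      by (cases "x + pi \<le> \<theta>") auto
    moreover have "max 0 (\<theta> - (x + pi)) = max 0 (\<bar>x - \<theta>\<bar> - pi)"
      using that assms by (auto simp: max_def abs_if)
    ultimately show ?thesis by simp
  qed
  then have "(\<integral>x. measure lborel {t \<in> {0..\<theta>}. (t, x) \<in> {z. snd z < -pi + fst z}} \<partial>\<nu>) = excess \<nu> \<theta>"
    unfolding excess_def using carried by (intro integral_cong_AE) (auto elim: eventually_mono)
  then show "(LBINT t:{0..\<theta>}. measure \<nu> {-pi..<-pi + t}) = excess \<nu> \<theta>"
    unfolding measure_lower_arc F(2) .
qed

text \<open>The mirror image: for \<open>\<theta> \<le> 0\<close> only points \<open>x\<close> close to \<open>\<pi>\<close> overshoot, by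
  \<open>x - \<pi> - \<theta>\<close>, the length of the set of \<open>t \<in> [\<theta>, 0]\<close> with \<open>\<pi> + t < x\<close>.\<close>

lemma excess_backward:
  assumes "-pi \<le> \<theta>" "\<theta> \<le> 0"
  shows "set_integrable lborel {\<theta>..0} (\<lambda>t. measure \<nu> {pi + t<..<pi})"
    and "(LBINT t:{\<theta>..0}. measure \<nu> {pi + t<..<pi}) = excess \<nu> \<theta>"
proof -
  have A: "{z. pi + fst z < snd z} \<in> sets (lborel \<Otimes>\<^sub>M \<nu>)"
    unfolding sets_plane by (intro borel_open open_Collect_less continuous_intros)
  have slice: "{x \<in> space \<nu>. (t, x) \<in> {z. pi + fst z < snd z}} = {pi + t<..}" for t
    by auto
  note F = Fubini_section_measure[OF finite_measure_axioms A, of \<theta> 0, unfolded slice]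
  show "set_integrable lborel {\<theta>..0} (\<lambda>t. measure \<nu> {pi + t<..<pi})"
    unfolding measure_upper_arc by (rule F(1))
  have "measure lborel {t \<in> {\<theta>..0}. (t, x) \<in> {z. pi + fst z < snd z}} = max 0 (\<bar>x - \<theta>\<bar> - pi)"
    if "x \<in> {-pi..<pi}" for x
  proof -
    have "{t \<in> {\<theta>..0}. (t, x) \<in> {z. pi + fst z < snd z}} = {\<theta>..<x - pi}"
      using that by auto
    moreover have "measure lborel {\<theta>..<x - pi} = max 0 (x - pi - \<theta>)"
      by (cases "\<theta> \<le> x - pi") auto
    moreover have "max 0 (x - pi - \<theta>) = max 0 (\<bar>x - \<theta>\<bar> - pi)"
      using that assms by (auto simp: max_def abs_if)
    ultimately show ?thesis by simp
  qed
  then have "(\<integral>x. measure lborel {t \<in> {\<theta>..0}. (t, x) \<in> {z. pi + fst z < snd z}} \<partial>\<nu>) = excess \<nu> \<theta>"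
    unfolding excess_def using carried by (intro integral_cong_AE) (auto elim: eventually_mono)
  then show "(LBINT t:{\<theta>..0}. measure \<nu> {pi + t<..<pi}) = excess \<nu> \<theta>"
    unfolding measure_upper_arc F(2) .
qed

text \<open>The fundamental theorem of calculus for the backward representation. The one-sided version is
  needed at 0, where only the left limit of the arc measure is under control; in the interior of
  \<open>[-\<pi>, 0]\<close> it is a two-sided derivative.\<close>

lemma excess_has_real_derivative:
  assumes x: "x \<in> {-pi..0}"
    and cont: "continuous (at x within {-pi..0}) (\<lambda>t. measure \<nu> {pi + t<..<pi})"
  shows "(excess \<nu> has_real_derivative - measure \<nu> {pi + x<..<pi}) (at x within {-pi..0})"
proof -
  let ?h = "\<lambda>t. measure \<nu> {pi + t<..<pi}"
  have int: "set_integrable lborel {-pi..0} ?h"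
    by (rule excess_backward) auto
  then have h: "?h integrable_on {-pi..0}"
    by (rule set_borel_integral_eq_integral)
  have eq: "excess \<nu> \<theta> = integral {-pi..0} ?h - integral {-pi..\<theta>} ?h" if "\<theta> \<in> {-pi..0}" for \<theta>
  proof -
    have "integral {\<theta>..0} ?h = excess \<nu> \<theta>"
      using excess_backward[of \<theta>] set_borel_integral_eq_integral(2)[of "{\<theta>..0}" ?h] that by simp
    then show ?thesis
      using Henstock_Kurzweil_Integration.integral_combine[OF _ _ h, of \<theta>] that by simp
  qed
  have "((\<lambda>\<theta>. integral {-pi..\<theta>} ?h) has_real_derivative ?h x) (at x within {-pi..0})"
    using integral_has_vector_derivative_continuous_at[OF h, of x "{}"] x cont
    by (simp add: has_real_derivative_iff_has_vector_derivative)
  then have "((\<lambda>\<theta>. integral {-pi..0} ?h - integral {-pi..\<theta>} ?h)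
      has_real_derivative - ?h x) (at x within {-pi..0})"
    by (auto intro!: derivative_eq_intros)
  then show ?thesis
    using x by (rule has_field_derivative_transform_within[OF _ zero_less_one]) (simp add: eq)
qed

text \<open>The arcs \<open>(\<pi> + t, \<pi>)\<close> shrink to the empty set as \<open>t\<close> increases to 0: the antipode of the
  base point is represented by \<open>-\<pi>\<close>, so an atom there lies outside all of these arcs.\<close>

lemma tendsto_upper_arc: "((\<lambda>t. measure \<nu> {pi + t<..<pi}) \<longlongrightarrow> 0) (at_left 0)"
proof -
  have "filterlim (\<lambda>t. pi + t) (at_left pi) (at_left (0::real))"
    unfolding filterlim_at
    by (auto intro!: tendsto_eq_intros simp: eventually_at_filter)
  then have "((\<lambda>t. cdf \<nu> (pi + t)) \<longlongrightarrow> measure \<nu> {..<pi}) (at_left 0)"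
    by (rule filterlim_compose[OF cdf_at_left])
  moreover have "measure \<nu> {..<pi} = 1"
    by (subst prob_eq_1) (use carried in \<open>auto elim: eventually_mono\<close>)
  ultimately show ?thesis
    unfolding measure_upper_arc_cdf by (auto intro!: tendsto_eq_intros)
qed

lemma continuous_upper_arc:
  assumes "measure \<nu> {pi + x} = 0"
  shows "isCont (\<lambda>t. measure \<nu> {pi + t<..<pi}) x"
  unfolding measure_upper_arc_cdf
  by (intro continuous_intros isCont_o2[of x "\<lambda>t. pi + t" "cdf \<nu>"]) (use assms isCont_cdf in auto)

end

section \<open>The angular image of a measure on the circle\<close>

lemma continuous_on_rot: "continuous_on A (rot p)"
proof -
  have "rot p = (\<lambda>\<theta>. cos \<theta> *\<^sub>R p + sin \<theta> *\<^sub>R vector [- p $ 2, p $ 1])"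
    by (simp add: fun_eq_iff vec_eq_iff forall_2)
  then show ?thesis by (simp add: continuous_intros)
qed

context
  fixes \<mu> :: "(real^2) measure" and p :: "real^2"
  assumes prob: "prob_space \<mu>"
    and sets: "sets \<mu> = sets (restrict_space borel circle)"
    and p: "p \<in> circle"
begin

lemma space_mu: "space \<mu> = circle"
  using sets_eq_imp_space_eq[OF sets] by (simp add: space_restrict_space)

lemma rot_inv_into: "x \<in> circle \<Longrightarrow> rot p (inv_into {-pi..<pi} (rot p) x) = x"
  using bij_betw_rot[OF p] by (auto simp: bij_betw_def intro: f_inv_into_f)

lemma inv_into_rot: "s \<in> {-pi..<pi} \<Longrightarrow> inv_into {-pi..<pi} (rot p) (rot p s) = s"
  using bij_betw_rot[OF p] by (auto simp: bij_betw_def intro: inv_into_f_f)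

lemma inv_into_range:
  "x \<in> circle \<Longrightarrow> inv_into {-pi..<pi} (rot p) x \<in> {-pi..<pi}"
  using bij_betw_rot[OF p] by (metis bij_betw_def inv_into_into)

text \<open>The sublevel sets of the angle are images of the compact intervals \<open>[-\<pi>, a]\<close> under a
  continuous map, hence closed. This avoids any explicit formula for the angle, which would have to
  treat the jump at the cut.\<close>

lemma measurable_inv_into_rot: "inv_into {-pi..<pi} (rot p) \<in> borel_measurable \<mu>"
proof -
  have "{x \<in> space \<mu>. inv_into {-pi..<pi} (rot p) x \<le> a} \<in> sets \<mu>" for a
  proof (cases "a < pi")
    case True
    have "{x \<in> space \<mu>. inv_into {-pi..<pi} (rot p) x \<le> a} = circle \<inter> rot p ` {-pi..a}"
      (is "?L = ?R")
    proof (intro equalityI subsetI)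
      fix x assume x: "x \<in> ?L"
      then show "x \<in> ?R"
        using inv_into_range[of x] rot_inv_into[of x]
        by (auto simp: space_mu intro!: image_eqI[of _ _ "inv_into {-pi..<pi} (rot p) x"])
    next
      fix x assume "x \<in> ?R"
      then obtain s where "x \<in> circle" "x = rot p s" "-pi \<le> s" "s \<le> a" by auto
      then show "x \<in> ?L"
        using True inv_into_rot[of s] by (auto simp: space_mu)
    qed
    moreover have "compact (rot p ` {-pi..a})"
      by (intro compact_continuous_image continuous_on_rot) auto
    ultimately show ?thesis
      unfolding sets by (auto simp: sets_restrict_space compact_imp_closed)
  next
    case False
    then have "{x \<in> space \<mu>. inv_into {-pi..<pi} (rot p) x \<le> a} = space \<mu>"
      using inv_into_range by (force simp: space_mu)
    then show ?thesis by simp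
  qed
  then show ?thesis by (simp add: borel_measurable_iff_le)
qed

lemma sets_angle_measure [simp, measurable_cong]: "sets (angle_measure \<mu> p) = sets borel"
  by (simp add: angle_measure_def)

lemma real_distribution_angle_measure: "real_distribution (angle_measure \<mu> p)"
proof -
  interpret prob_space \<mu> by (rule prob)
  show ?thesis
    unfolding angle_measure_def
    by (intro real_distribution_distr) (rule measurable_inv_into_rot)
qed

interpretation nu: real_distribution "angle_measure \<mu> p"
  by (rule real_distribution_angle_measure)

lemma AE_angle_measure: "AE s in angle_measure \<mu> p. s \<in> {-pi..<pi}"
  unfolding angle_measure_def
  by (subst AE_distr_iff[OF measurable_inv_into_rot])
     (use inv_into_range in \<open>auto simp: space_mu\<close>)

lemma integrable_angle_measure [simp]: "integrable (angle_measure \<mu> p) (\<lambda>s. s)"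
proof (rule nu.integrable_const_bound)
  show "AE s in angle_measure \<mu> p. norm s \<le> pi"
    using AE_angle_measure by eventually_elim auto
qed simp

lemma measure_angle_measure_singleton:
  assumes "s \<in> {-pi..<pi}"
  shows "measure (angle_measure \<mu> p) {s} = measure \<mu> {rot p s}"
proof -
  have "inv_into {-pi..<pi} (rot p) -` {s} \<inter> space \<mu> = {rot p s}"
    using assms inv_into_rot[OF assms] rot_inv_into p by (auto simp: space_mu)
  then show ?thesis
    unfolding angle_measure_def by (subst measure_distr[OF measurable_inv_into_rot]) auto
qed

text \<open>The squared distance is integrated term by term. At \<open>\<theta> = 0\<close> there is no overshoot, which
  identifies the second moment of the angular law with \<open>2 F(p)\<close>.\<close>

lemma frechet_lift_expansion:
  assumes "\<bar>\<theta>\<bar> \<le> pi"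
  shows "frechet_lift \<mu> p \<theta>
    = frechet_functional \<mu> p + \<theta>\<^sup>2 / 2 - \<theta> * (\<integral>s. s \<partial>angle_measure \<mu> p) - 2 * pi * excess (angle_measure \<mu> p) \<theta>"
proof -
  have lift: "2 * frechet_lift \<mu> p \<theta>
      = (\<integral>s. (s - \<theta>)\<^sup>2 - 4 * pi * max 0 (\<bar>s - \<theta>\<bar> - pi) \<partial>angle_measure \<mu> p)"
    if "\<bar>\<theta>\<bar> \<le> pi" for \<theta>
  proof -
    have "2 * frechet_lift \<mu> p \<theta> = (\<integral>x. (circle_dist x (rot p \<theta>))\<^sup>2 \<partial>\<mu>)"
      by (simp add: frechet_lift_def frechet_functional_def)
    also have "\<dots> = (\<integral>x. (inv_into {-pi..<pi} (rot p) x - \<theta>)\<^sup>2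
        - 4 * pi * max 0 (\<bar>inv_into {-pi..<pi} (rot p) x - \<theta>\<bar> - pi) \<partial>\<mu>)"
    proof (intro Bochner_Integration.integral_cong refl)
      fix x assume "x \<in> space \<mu>"
      then have x: "x \<in> circle" by (simp add: space_mu)
      have "\<bar>inv_into {-pi..<pi} (rot p) x - \<theta>\<bar> \<le> 2 * pi"
        using inv_into_range[OF x] that by auto
      then show "(circle_dist x (rot p \<theta>))\<^sup>2 = (inv_into {-pi..<pi} (rot p) x - \<theta>)\<^sup>2
        - 4 * pi * max 0 (\<bar>inv_into {-pi..<pi} (rot p) x - \<theta>\<bar> - pi)"
        using circle_dist_rot_squared[OF p, of "inv_into {-pi..<pi} (rot p) x" \<theta>]
          rot_inv_into[OF x] by simp
    qed
    also have "\<dots> = (\<integral>s. (s - \<theta>)\<^sup>2 - 4 * pi * max 0 (\<bar>s - \<theta>\<bar> - pi) \<partial>angle_measure \<mu> p)"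
      unfolding angle_measure_def
      by (rule integral_distr[symmetric, OF measurable_inv_into_rot]) measurable
    finally show ?thesis .
  qed
  have int2: "integrable (angle_measure \<mu> p) (\<lambda>s. s\<^sup>2)"
  proof (rule nu.integrable_const_bound)
    show "AE s in angle_measure \<mu> p. norm (s\<^sup>2) \<le> pi\<^sup>2"
      using AE_angle_measure by eventually_elim (auto simp: abs_le_square_iff[symmetric])
  qed simp
  have intm: "integrable (angle_measure \<mu> p) (\<lambda>s. max 0 (\<bar>s - \<theta>\<bar> - pi))"
    by (intro Bochner_Integration.integrable_max integrable_diff integrable_abs) auto
  have zero: "2 * frechet_functional \<mu> p = (\<integral>s. s\<^sup>2 \<partial>angle_measure \<mu> p)"
  proof -
    have "2 * frechet_functional \<mu> p = (\<integral>s. s\<^sup>2 - 4 * pi * max 0 (\<bar>s\<bar> - pi) \<partial>angle_measure \<mu> p)"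
      using lift[of 0] by (simp add: frechet_lift_def)
    also have "\<dots> = (\<integral>s. s\<^sup>2 \<partial>angle_measure \<mu> p)"
    proof (rule integral_cong_AE)
      show "AE s in angle_measure \<mu> p. s\<^sup>2 - 4 * pi * max 0 (\<bar>s\<bar> - pi) = s\<^sup>2"
        using AE_angle_measure by eventually_elim (auto simp: max_def)
    qed simp_all
    finally show ?thesis .
  qed
  have "2 * frechet_lift \<mu> p \<theta>
      = (\<integral>s. s\<^sup>2 - 2 * \<theta> * s + \<theta>\<^sup>2 - 4 * pi * max 0 (\<bar>s - \<theta>\<bar> - pi) \<partial>angle_measure \<mu> p)"
    unfolding lift[OF assms] by (simp add: power2_diff algebra_simps)
  also have "\<dots> = (\<integral>s. s\<^sup>2 \<partial>angle_measure \<mu> p) - 2 * \<theta> * (\<integral>s. s \<partial>angle_measure \<mu> p) + \<theta>\<^sup>2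
      - 4 * pi * excess (angle_measure \<mu> p) \<theta>"
    using int2 intm unfolding excess_def by (simp add: nu.prob_space[simplified])
  finally show ?thesis unfolding zero[symmetric] by simp
qed

section \<open>Critical points have vanishing mean angle\<close>

abbreviation (input) "mean_angle \<equiv> \<integral>s. s \<partial>angle_measure \<mu> p"

lemma frechet_lift_has_left_derivative:
  assumes \<theta>: "\<theta> \<in> {-pi..0}"
    and cont: "continuous (at \<theta> within {-pi..0}) (\<lambda>t. measure (angle_measure \<mu> p) {pi + t<..<pi})"
  shows "(frechet_lift \<mu> p has_real_derivative
    \<theta> - mean_angle + 2 * pi * measure (angle_measure \<mu> p) {pi + \<theta><..<pi}) (at \<theta> within {-pi..0})"
proof -
  have "((\<lambda>\<theta>. frechet_functional \<mu> p + \<theta>\<^sup>2 / 2 - \<theta> * mean_angle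
        - 2 * pi * excess (angle_measure \<mu> p) \<theta>) has_real_derivative
      \<theta> - mean_angle + 2 * pi * measure (angle_measure \<mu> p) {pi + \<theta><..<pi}) (at \<theta> within {-pi..0})"
    by (auto intro!: derivative_eq_intros
        excess_has_real_derivative[OF real_distribution_angle_measure AE_angle_measure \<theta> cont])
  then show ?thesis
    using \<theta> by (rule has_field_derivative_transform_within[OF _ zero_less_one])
      (auto simp: frechet_lift_expansion)
qed

text \<open>Seen from \<open>p\<close> instead of the base point \<open>p\<^sub>0\<close>, the lift is only translated, so the
  one-sided derivative formula applies near \<open>\<theta>\<^sub>0\<close>. Without an atom at the antipode, the derivative
  0 must agree with the derivative \<open>-m\<close> from the left; with an atom, the limit 0 of the
  derivatives must agree with their limit \<open>-m\<close>.\<close>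

lemma mean_angle_eq_zero_if_critical:
  assumes "frechet_critical_point \<mu> p"
  shows "mean_angle = 0"
proof -
  let ?h = "\<lambda>t. measure (angle_measure \<mu> p) {pi + t<..<pi}"
  have lim: "(?h \<longlongrightarrow> 0) (at_left 0)"
    by (rule tendsto_upper_arc[OF real_distribution_angle_measure AE_angle_measure])
  obtain p\<^sub>0 \<theta>\<^sub>0 where p\<^sub>0: "p = rot p\<^sub>0 \<theta>\<^sub>0" and deriv: "has_extended_deriv \<mu> p\<^sub>0 0 \<theta>\<^sub>0"
    using assms unfolding frechet_critical_point_def by blast
  have shift: "frechet_lift \<mu> p = (\<lambda>s. frechet_lift \<mu> p\<^sub>0 (s + \<theta>\<^sub>0))"
    by (simp add: fun_eq_iff frechet_lift_def p\<^sub>0 rot_rot add.commute)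
  show ?thesis
  proof (cases "measure \<mu> {- rot p\<^sub>0 \<theta>\<^sub>0} = 0")
    case True
    then have "(frechet_lift \<mu> p\<^sub>0 has_real_derivative 0) (at (0 + \<theta>\<^sub>0))"
      using deriv by (simp add: has_extended_deriv_def)
    then have "(frechet_lift \<mu> p has_real_derivative 0) (at 0)"
      unfolding shift by (rule DERIV_shift[THEN iffD1])
    then have "(frechet_lift \<mu> p has_real_derivative 0) (at 0 within {-pi..0})"
      by (rule has_field_derivative_at_within)
    moreover have "(frechet_lift \<mu> p has_real_derivative
        0 - mean_angle + 2 * pi * ?h 0) (at 0 within {-pi..0})"
      by (rule frechet_lift_has_left_derivative)
         (use lim in \<open>auto simp: continuous_within at_within_Icc_at_left\<close>)
    ultimately have "0 = 0 - mean_angle + 2 * pi * ?h 0"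
      by (rule has_field_derivative_unique) (simp add: at_within_Icc_at_left)
    then show ?thesis by simp
  next
    case False
    define S where "S = {s. s < \<theta>\<^sub>0 \<and> measure \<mu> {- rot p\<^sub>0 s} = 0}"
    have antipode: "measure \<mu> {- rot p\<^sub>0 s} = measure (angle_measure \<mu> p) {pi + (s - \<theta>\<^sub>0)}"
      if "s \<in> {\<theta>\<^sub>0 - pi<..<\<theta>\<^sub>0}" for s
    proof -
      have "- rot p\<^sub>0 s = rot p (pi + (s - \<theta>\<^sub>0))"
        by (simp add: minus_rot p\<^sub>0 rot_rot algebra_simps)
      then show ?thesis
        using that by (simp add: measure_angle_measure_singleton)
    qed
    have S_left: "at \<theta>\<^sub>0 within S \<le> at_left \<theta>\<^sub>0"
      by (rule at_le) (auto simp: S_def)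
    \<comment> \<open>The limit along \<open>S\<close> determines its value only because \<open>S\<close> accumulates at \<open>\<theta>\<^sub>0\<close>: an
      interval to the left of \<open>\<theta>\<^sub>0\<close> is uncountable, whereas the atoms are countable.\<close>
    have "\<theta>\<^sub>0 islimpt S"
      unfolding islimpt_approachable
    proof (intro allI impI)
      fix e :: real assume "e > 0"
      define d where "d = min e pi"
      have d: "d > 0" "d \<le> e" "d \<le> pi" using \<open>e > 0\<close> by (auto simp: d_def)
      interpret nu: real_distribution "angle_measure \<mu> p"
        by (rule real_distribution_angle_measure)
      have "countable ((\<lambda>u. u - pi + \<theta>\<^sub>0) ` {u. measure (angle_measure \<mu> p) {u} \<noteq> 0})"
        by (intro countable_image nu.countable_support)
      moreover have "uncountable {\<theta>\<^sub>0 - d<..<\<theta>\<^sub>0}"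
        using d by (simp add: uncountable_open_interval)
      ultimately obtain s where s: "s \<in> {\<theta>\<^sub>0 - d<..<\<theta>\<^sub>0}"
          "s \<notin> (\<lambda>u. u - pi + \<theta>\<^sub>0) ` {u. measure (angle_measure \<mu> p) {u} \<noteq> 0}"
        by (meson countable_subset subsetI)
      have "measure (angle_measure \<mu> p) {pi + (s - \<theta>\<^sub>0)} = 0"
        using s(2) by (force intro!: image_eqI[of _ _ "pi + (s - \<theta>\<^sub>0)"])
      then have "s \<in> S"
        using s(1) d antipode[of s] by (simp add: S_def)
      then show "\<exists>s\<in>S. s \<noteq> \<theta>\<^sub>0 \<and> dist s \<theta>\<^sub>0 < e"
        using s(1) d by (intro bexI[of _ s]) (auto simp: dist_real_def)
    qed
    then have nontrivial: "at \<theta>\<^sub>0 within S \<noteq> bot"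
      by (simp add: trivial_limit_within)
    have "deriv (frechet_lift \<mu> p\<^sub>0) s = (s - \<theta>\<^sub>0) - mean_angle + 2 * pi * ?h (s - \<theta>\<^sub>0)"
      if "s \<in> S" "s \<in> {\<theta>\<^sub>0 - pi<..<\<theta>\<^sub>0}" for s
    proof (rule DERIV_imp_deriv)
      let ?D = "(s - \<theta>\<^sub>0) - mean_angle + 2 * pi * ?h (s - \<theta>\<^sub>0)"
      have "isCont ?h (s - \<theta>\<^sub>0)"
        using that antipode[of s]
        by (intro continuous_upper_arc[OF real_distribution_angle_measure AE_angle_measure])
           (simp add: S_def)
      then have "(frechet_lift \<mu> p has_real_derivative ?D) (at (s - \<theta>\<^sub>0) within {-pi..0})"
        using that(2) by (intro frechet_lift_has_left_derivative) (auto intro: continuous_at_imp_continuous_at_within)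
      moreover have "at (s - \<theta>\<^sub>0) within {-pi..0} = at (s - \<theta>\<^sub>0)"
        using that(2) by (intro at_within_Icc_at) auto
      ultimately have "(frechet_lift \<mu> p has_real_derivative ?D) (at (s - \<theta>\<^sub>0))"
        by simp
      then have "(frechet_lift \<mu> p\<^sub>0 has_real_derivative ?D) (at (s - \<theta>\<^sub>0 + \<theta>\<^sub>0))"
        unfolding shift by (rule DERIV_shift[THEN iffD2])
      then show "(frechet_lift \<mu> p\<^sub>0 has_real_derivative ?D) (at s)" by simp
    qed
    moreover have "eventually (\<lambda>s. s \<in> {\<theta>\<^sub>0 - pi<..<\<theta>\<^sub>0}) (at_left \<theta>\<^sub>0)"
      by (rule eventually_at_leftI[of "\<theta>\<^sub>0 - pi"]) auto
    then have "eventually (\<lambda>s. s \<in> {\<theta>\<^sub>0 - pi<..<\<theta>\<^sub>0}) (at \<theta>\<^sub>0 within S)"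
      by (rule filter_leD[OF S_left])
    moreover have "eventually (\<lambda>s. s \<in> S) (at \<theta>\<^sub>0 within S)"
      by (simp add: eventually_at_filter)
    ultimately have "eventually (\<lambda>s. deriv (frechet_lift \<mu> p\<^sub>0) s
        = (s - \<theta>\<^sub>0) - mean_angle + 2 * pi * ?h (s - \<theta>\<^sub>0)) (at \<theta>\<^sub>0 within S)"
      by (auto elim: eventually_elim2)
    moreover have "(deriv (frechet_lift \<mu> p\<^sub>0) \<longlongrightarrow> 0) (at \<theta>\<^sub>0 within S)"
      using deriv False by (simp add: has_extended_deriv_def S_def)
    ultimately have "((\<lambda>s. (s - \<theta>\<^sub>0) - mean_angle + 2 * pi * ?h (s - \<theta>\<^sub>0)) \<longlongrightarrow> 0) (at \<theta>\<^sub>0 within S)"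
      by (rule Lim_transform_eventually[rotated])
    moreover have "((\<lambda>s. (s - \<theta>\<^sub>0) - mean_angle + 2 * pi * ?h (s - \<theta>\<^sub>0))
        \<longlongrightarrow> 0 - mean_angle + 2 * pi * 0) (at \<theta>\<^sub>0 within S)"
    proof -
      have "filterlim (\<lambda>s. s - \<theta>\<^sub>0) (at_left 0) (at_left \<theta>\<^sub>0)"
        unfolding filterlim_at by (auto intro!: tendsto_eq_intros simp: eventually_at_filter)
      then have "((\<lambda>s. ?h (s - \<theta>\<^sub>0)) \<longlongrightarrow> 0) (at_left \<theta>\<^sub>0)"
        by (rule filterlim_compose[OF lim])
      then have "((\<lambda>s. ?h (s - \<theta>\<^sub>0)) \<longlongrightarrow> 0) (at \<theta>\<^sub>0 within S)"
        by (rule tendsto_mono[OF S_left])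
      then show ?thesis
        by (intro tendsto_intros) (auto intro!: tendsto_eq_intros)
    qed
    ultimately have "0 = 0 - mean_angle + 2 * pi * 0"
      by (rule tendsto_unique[OF nontrivial])
    then show ?thesis by simp
  qed
qed

section \<open>Comparison with the uniform law\<close>

text \<open>The uniform law assigns \<open>t/(2 \<pi>)\<close> to the arc \<open>[-\<pi>, -\<pi> + t)\<close>, so its part of the integral
  reproduces the parabola of the expansion.\<close>

lemma frechet_lift_minus_forward:
  assumes "mean_angle = 0" "0 \<le> \<theta>" "\<theta> \<le> pi"
  shows "frechet_lift \<mu> p \<theta> - frechet_functional \<mu> p
    = 2 * pi * (LBINT t:{0..\<theta>}. measure uniform_angle {-pi..<-pi + t}
                      - measure (angle_measure \<mu> p) {-pi..<-pi + t})"
proof -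
  have ordered: "0 \<le> \<theta>" by (rule assms)
  note uniform_part = set_integral_linear[OF ordered, of "1 / (2 * pi)"]
  note excess_part = excess_forward[OF real_distribution_angle_measure AE_angle_measure assms(2,3)]
  have "(LBINT t:{0..\<theta>}. measure uniform_angle {-pi..<-pi + t}
                      - measure (angle_measure \<mu> p) {-pi..<-pi + t})
      = (LBINT t:{0..\<theta>}. 1 / (2 * pi) * t - measure (angle_measure \<mu> p) {-pi..<-pi + t})"
    using assms by (intro set_lebesgue_integral_cong) (auto simp: measure_uniform_angle)
  also have "\<dots> = (LBINT t:{0..\<theta>}. 1 / (2 * pi) * t) - (LBINT t:{0..\<theta>}. measure (angle_measure \<mu> p) {-pi..<-pi + t})"
    by (rule set_integral_diff(2)[OF uniform_part(1) excess_part(1)])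
  also have "\<dots> = \<theta>\<^sup>2 / (4 * pi) - excess (angle_measure \<mu> p) \<theta>"
    unfolding uniform_part(2) excess_part(2) by simp
  finally have gap: "(LBINT t:{0..\<theta>}. measure uniform_angle {-pi..<-pi + t}
                      - measure (angle_measure \<mu> p) {-pi..<-pi + t})
      = \<theta>\<^sup>2 / (4 * pi) - excess (angle_measure \<mu> p) \<theta>" .
  have "\<bar>\<theta>\<bar> \<le> pi"
    using assms(2,3) by simp
  from frechet_lift_expansion[OF this] show ?thesis
    unfolding gap assms(1) by (simp add: right_diff_distrib)
qed

lemma frechet_lift_minus_backward:
  assumes "mean_angle = 0" "-pi \<le> \<theta>" "\<theta> \<le> 0"
  shows "frechet_lift \<mu> p \<theta> - frechet_functional \<mu> p
    = 2 * pi * (LBINT t:{\<theta>..0}. measure uniform_angle {pi + t<..<pi}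
                      - measure (angle_measure \<mu> p) {pi + t<..<pi})"
proof -
  have ordered: "\<theta> \<le> 0" by (rule assms)
  note uniform_part = set_integral_linear[OF ordered, of "- 1 / (2 * pi)"]
  note excess_part = excess_backward[OF real_distribution_angle_measure AE_angle_measure assms(2,3)]
  have uniform: "measure uniform_angle {pi + t<..<pi} = - 1 / (2 * pi) * t" if "t \<in> {\<theta>..0}" for t
    using that assms pi_gt_zero by (subst measure_uniform_angle) auto
  have "(LBINT t:{\<theta>..0}. measure uniform_angle {pi + t<..<pi}
                      - measure (angle_measure \<mu> p) {pi + t<..<pi})
      = (LBINT t:{\<theta>..0}. - 1 / (2 * pi) * t - measure (angle_measure \<mu> p) {pi + t<..<pi})"
    by (intro set_lebesgue_integral_cong) (use uniform in auto)
  also have "\<dots> = (LBINT t:{\<theta>..0}. - 1 / (2 * pi) * t) - (LBINT t:{\<theta>..0}. measure (angle_measure \<mu> p) {pi + t<..<pi})"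
    by (rule set_integral_diff(2)[OF uniform_part(1) excess_part(1)])
  also have "\<dots> = \<theta>\<^sup>2 / (4 * pi) - excess (angle_measure \<mu> p) \<theta>"
    unfolding uniform_part(2) excess_part(2) by simp
  finally have gap: "(LBINT t:{\<theta>..0}. measure uniform_angle {pi + t<..<pi}
                      - measure (angle_measure \<mu> p) {pi + t<..<pi})
      = \<theta>\<^sup>2 / (4 * pi) - excess (angle_measure \<mu> p) \<theta>" .
  have "\<bar>\<theta>\<bar> \<le> pi"
    using assms(2,3) by simp
  from frechet_lift_expansion[OF this] show ?thesis
    unfolding gap assms(1) by (simp add: right_diff_distrib)
qed

text \<open>Unique minimality is strict minimality, and each point of the circle other than \<open>p\<close> is a
  rotation of \<open>p\<close> by exactly one nonzero angle in \<open>[-\<pi>, \<pi>)\<close>.\<close>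

lemma well_defined_frechet_mean_iff:
  "well_defined_frechet_mean \<mu> p \<longleftrightarrow>
    (\<forall>\<theta>\<in>{-pi..<pi}. \<theta> \<noteq> 0 \<longrightarrow> frechet_functional \<mu> p < frechet_lift \<mu> p \<theta>)"
proof -
  have "well_defined_frechet_mean \<mu> p \<longleftrightarrow>
      (\<forall>q\<in>circle. q \<noteq> p \<longrightarrow> frechet_functional \<mu> p < frechet_functional \<mu> q)"
    (is "?L \<longleftrightarrow> ?R")
  proof
    assume L: ?L
    show ?R
    proof (intro ballI impI)
      fix q assume "q \<in> circle" "q \<noteq> p"
      then obtain y where "y \<in> circle" "frechet_functional \<mu> y < frechet_functional \<mu> q"
        using L unfolding well_defined_frechet_mean_def is_frechet_mean_def is_arg_min_def by metis
      moreover have "\<not> frechet_functional \<mu> y < frechet_functional \<mu> p"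
        using L \<open>y \<in> circle\<close>
        unfolding well_defined_frechet_mean_def is_frechet_mean_def is_arg_min_def by metis
      ultimately show "frechet_functional \<mu> p < frechet_functional \<mu> q" by linarith
    qed
  next
    assume ?R
    then show ?L
      using p unfolding well_defined_frechet_mean_def is_frechet_mean_def is_arg_min_def
      by (metis less_asym)
  qed
  also have "\<dots> \<longleftrightarrow> (\<forall>\<theta>\<in>{-pi..<pi}. rot p \<theta> \<noteq> p \<longrightarrow> frechet_functional \<mu> p < frechet_lift \<mu> p \<theta>)"
    unfolding frechet_lift_def bij_betw_imp_surj_on[OF bij_betw_rot[OF p], symmetric] by blast
  also have "\<dots> \<longleftrightarrow> (\<forall>\<theta>\<in>{-pi..<pi}. \<theta> \<noteq> 0 \<longrightarrow> frechet_functional \<mu> p < frechet_lift \<mu> p \<theta>)"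
  proof -
    have "rot p \<theta> = p \<longleftrightarrow> \<theta> = 0" if "\<theta> \<in> {-pi..<pi}" for \<theta>
      using inj_onD[OF bij_betw_imp_inj_on[OF bij_betw_rot[OF p]], of \<theta> 0] that by auto
    then show ?thesis by blast
  qed
  finally show ?thesis .
qed

end

theorem theorem4p1:
  fixes \<mu> :: "(real^2) measure" and p :: "real^2"
  assumes "prob_space \<mu>"
    and "sets \<mu> = sets (restrict_space borel circle)"
    and "p \<in> circle"
    and "frechet_critical_point \<mu> p"
  shows "well_defined_frechet_mean \<mu> p \<longleftrightarrow>
    (\<forall>\<theta>. 0 < \<theta> \<and> \<theta> < pi \<longrightarrow>
      (LBINT t:{0..\<theta>}. measure uniform_angle {-pi..<-pi + t}
                      - measure (angle_measure \<mu> p) {-pi..<-pi + t}) > 0) \<and>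
    (\<forall>\<theta>. -pi \<le> \<theta> \<and> \<theta> < 0 \<longrightarrow>
      (LBINT t:{\<theta>..0}. measure uniform_angle {pi + t<..<pi}
                      - measure (angle_measure \<mu> p) {pi + t<..<pi}) > 0)"
proof -
  note mean = mean_angle_eq_zero_if_critical[OF assms]
  have gap_pos: "a < b \<longleftrightarrow> 0 < g" if "b - a = 2 * pi * g" for a b g :: real
    using that pi_gt_zero by (metis diff_gt_0_iff_gt mult_pos_pos zero_less_mult_pos zero_less_numeral)
  have forward: "frechet_functional \<mu> p < frechet_lift \<mu> p \<theta> \<longleftrightarrow>
      (LBINT t:{0..\<theta>}. measure uniform_angle {-pi..<-pi + t}
                      - measure (angle_measure \<mu> p) {-pi..<-pi + t}) > 0"
    if "0 < \<theta> \<and> \<theta> < pi" for \<theta>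
    using frechet_lift_minus_forward[OF assms(1-3) mean, of \<theta>] that by (simp add: gap_pos)
  have backward: "frechet_functional \<mu> p < frechet_lift \<mu> p \<theta> \<longleftrightarrow>
      (LBINT t:{\<theta>..0}. measure uniform_angle {pi + t<..<pi}
                      - measure (angle_measure \<mu> p) {pi + t<..<pi}) > 0"
    if "-pi \<le> \<theta> \<and> \<theta> < 0" for \<theta>
    using frechet_lift_minus_backward[OF assms(1-3) mean, of \<theta>] that by (simp add: gap_pos)
  have "well_defined_frechet_mean \<mu> p \<longleftrightarrow>
      (\<forall>\<theta>. 0 < \<theta> \<and> \<theta> < pi \<longrightarrow> frechet_functional \<mu> p < frechet_lift \<mu> p \<theta>) \<and>
      (\<forall>\<theta>. -pi \<le> \<theta> \<and> \<theta> < 0 \<longrightarrow> frechet_functional \<mu> p < frechet_lift \<mu> p \<theta>)"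
    unfolding well_defined_frechet_mean_iff[OF assms(1-3)] by (auto simp: neq_iff)
  then show ?thesis
    using forward backward by simp
qed

end
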